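(* $\mathbf{I}\mathbb{N}_{\infty}$, the semigroup of all partial cofinite isometries of $\mathbb{N}$, is an $F$-inverse semigroup.
   Context: $\mathbb{N}=\{1,2,3,\ldots\}$ with the metric $d(n,m)=|n-m|$. $\mathbf{I}\mathbb{N}_{\infty}$ is the inverse monoid of all partial maps $\alpha:\mathbb{N}\rightharpoonup\mathbb{N}$ such that $\mathbb{N}\setminus\operatorname{dom}\alpha$ and $\mathbb{N}\setminus\operatorname{ran}\alpha$ are finite and $|(x)\alpha-(y)\alpha|=|x-y|$ for all $x,y\in\operatorname{dom}\alpha$, with composition written left to right: $(x)(\alpha\beta)=((x)\alpha)\beta$, $\operatorname{dom}(\alpha\beta)=\{x\in\operatorname{dom}\alpha:(x)\alpha\in\operatorname{dom}\beta\}$. On an inverse semigroup $S$: the natural partial order is $s\preccurlyeq t$ iff $s=te$ for some idempotent $e\in S$; the least group congruence $\mathfrak{C}_{\mathbf{mg}}$ is given by $s\,\mathfrak{C}_{\mathbf{mg}}\,t$ iff $es=et$ for some idempotent $e\in S$. An inverse semigroup $S$ is $F$-inverse if the $\mathfrak{C}_{\mathbf{mg}}$-class of every element $s\in S$ has a greatest element with respect to $\preccurlyeq$. *)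

theory Defs
  imports "HOL-Algebra.Group"
begin

text \<open>
  Semigroups are carried by the \<open>monoid\<close> record; the field \<open>one\<close> plays no role in the
  definitions below.
\<close>

locale inverse_semigroup =
  fixes S (structure)
  assumes mult_closed: "\<lbrakk>x \<in> carrier S; y \<in> carrier S\<rbrakk> \<Longrightarrow> x \<otimes> y \<in> carrier S"
    and mult_assoc: "\<lbrakk>x \<in> carrier S; y \<in> carrier S; z \<in> carrier S\<rbrakk>
      \<Longrightarrow> (x \<otimes> y) \<otimes> z = x \<otimes> (y \<otimes> z)"
    and unique_inverse: "x \<in> carrier S
      \<Longrightarrow> \<exists>!y. y \<in> carrier S \<and> x \<otimes> y \<otimes> x = x \<and> y \<otimes> x \<otimes> y = y"

definition idempotents :: "('a, 'm) monoid_scheme \<Rightarrow> 'a set" where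
  "idempotents S = {e \<in> carrier S. e \<otimes>\<^bsub>S\<^esub> e = e}"

definition natural_order :: "('a, 'm) monoid_scheme \<Rightarrow> 'a gorder" where
  "natural_order S =
     \<lparr>carrier = carrier S, eq = (=), le = (\<lambda>s t. \<exists>e \<in> idempotents S. s = t \<otimes>\<^bsub>S\<^esub> e)\<rparr>"

definition least_group_congruence :: "('a, 'm) monoid_scheme \<Rightarrow> 'a rel" where
  "least_group_congruence S =
     {(s, t). s \<in> carrier S \<and> t \<in> carrier S \<and>
        (\<exists>e \<in> idempotents S. e \<otimes>\<^bsub>S\<^esub> s = e \<otimes>\<^bsub>S\<^esub> t)}"

locale F_inverse_semigroup = inverse_semigroup +
  assumes class_has_greatest: "s \<in> carrier S
    \<Longrightarrow> \<exists>m. greatest (natural_order S) m (least_group_congruence S `` {s})"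

text \<open>
  The positive integers are the subset \<open>{1..}\<close> of type \<open>nat\<close>. Distances are computed in
  \<open>int\<close> because subtraction on \<open>nat\<close> truncates. Products act from left to right, whereas
  \<open>\<circ>\<^sub>m\<close> applies its right argument first. No injectivity condition is needed: it follows
  from the isometry condition.
\<close>

definition partial_cofinite_isometries :: "(nat \<rightharpoonup> nat) set" where
  "partial_cofinite_isometries =
     {\<alpha>. dom \<alpha> \<subseteq> {1..} \<and> ran \<alpha> \<subseteq> {1..} \<and>
         finite ({1..} - dom \<alpha>) \<and> finite ({1..} - ran \<alpha>) \<and>
         (\<forall>x \<in> dom \<alpha>. \<forall>y \<in> dom \<alpha>.
            \<bar>int (the (\<alpha> x)) - int (the (\<alpha> y))\<bar> = \<bar>int x - int y\<bar>)}"

definition IN_infinity :: "(nat \<rightharpoonup> nat) monoid" where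
  "IN_infinity =
     \<lparr>carrier = partial_cofinite_isometries,
      mult = (\<lambda>\<alpha> \<beta>. \<beta> \<circ>\<^sub>m \<alpha>),
      one = Some |` {1..}\<rparr>"

end

theory Submission
  imports Defs
begin

text \<open>
  A cofinite partial isometry is a restricted translation. Indeed, a point far to the right of
  \<open>x\<close> cannot be sent to the left of the image of \<open>x\<close>, since it would have to land below zero;
  so every sufficiently large point is displaced by exactly as much as \<open>x\<close> is, and any two
  displacements agree by comparison with a common large point
  (\<open>isometry_on_unbounded_is_translation\<close>). Thus \<open>IN_infinity\<close> consists of the translations by
  integers \<open>k\<close>, each restricted to a cofinite set of positive integers that it keeps positive.

  The inverse of such a map is the translation by \<open>-k\<close> on its range. Two maps related by the
  least group congruence agree somewhere, because products have nonempty domains, and hence they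
  have the same displacement \<open>k\<close> (\<open>least_group_congruence_same_displacement\<close>). Conversely, the class with displacement \<open>k\<close> contains
  \<open>full_translation k\<close>, the translation by \<open>k\<close> on the largest possible domain. All the others in
  the class are obtained from it by cutting down the range, that is, by multiplying
  on the right by a partial identity, so it is the greatest element of the class
  (\<open>full_translation_congruent\<close>, \<open>le_full_translation\<close>).
\<close>

section \<open>Restricted translations\<close>

definition translation_on :: "int \<Rightarrow> nat set \<Rightarrow> nat \<rightharpoonup> nat" where
  "translation_on k D = (\<lambda>x. if x \<in> D then Some (nat (int x + k)) else None)"

definition full_translation :: "int \<Rightarrow> nat \<rightharpoonup> nat" where
  "full_translation k = translation_on k {x. 1 \<le> x \<and> 1 \<le> int x + k}"

lemma dom_translation_on [simp]: "dom (translation_on k D) = D"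
  by (auto simp: translation_on_def dom_def)

lemma ran_translation_on: "ran (translation_on k D) = (\<lambda>x. nat (int x + k)) ` D"
  by (auto simp: translation_on_def ran_def)

lemma translation_on_comp:
  assumes "\<And>x. x \<in> D \<Longrightarrow> 1 \<le> int x + k"
  shows "translation_on l E \<circ>\<^sub>m translation_on k D
    = translation_on (k + l) {x \<in> D. nat (int x + k) \<in> E}"
proof
  fix x
  show "(translation_on l E \<circ>\<^sub>m translation_on k D) x
    = translation_on (k + l) {x \<in> D. nat (int x + k) \<in> E} x"
    using assms[of x] by (auto simp: translation_on_def map_comp_def add.assoc)
qed

text \<open>The range is cofinite too: a positive integer is missed only if it is at most \<open>k\<close> or is the translate of a positive integer outside the domain.\<close>

lemma translation_on_mem:
  assumes D: "D \<subseteq> {1..}" "finite ({1..} - D)"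
    and pos: "\<And>x. x \<in> D \<Longrightarrow> 1 \<le> int x + k"
  shows "translation_on k D \<in> partial_cofinite_isometries"
proof -
  let ?h = "\<lambda>x. nat (int x + k)"
  have "{1..} - ?h ` D \<subseteq> {..nat k} \<union> ?h ` ({1..} - D)"
  proof
    fix y assume y: "y \<in> {1..} - ?h ` D"
    show "y \<in> {..nat k} \<union> ?h ` ({1..} - D)"
    proof (cases "int y \<le> k")
      case False
      then have "?h (nat (int y - k)) = y" "nat (int y - k) \<in> {1..}"
        by auto
      with y show ?thesis
        by (metis DiffD2 DiffI UnI2 image_eqI)
    qed auto
  qed
  then have "finite ({1..} - ?h ` D)"
    using D(2) by (meson finite_UnI finite_atMost finite_imageI finite_subset)
  moreover have "?h ` D \<subseteq> {1..}"
    using pos by force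
  moreover have "\<bar>int (the (translation_on k D x)) - int (the (translation_on k D y))\<bar>
      = \<bar>int x - int y\<bar>" if "x \<in> D" "y \<in> D" for x y
    using that pos[of x] pos[of y] by (simp add: translation_on_def)
  ultimately show ?thesis
    using D by (simp add: partial_cofinite_isometries_def ran_translation_on)
qed

lemma full_translation_mem: "full_translation k \<in> partial_cofinite_isometries"
  unfolding full_translation_def
proof (rule translation_on_mem)
  have "{1..} - {x. 1 \<le> x \<and> 1 \<le> int x + k} \<subseteq> {..nat (- k)}"
    by auto
  then show "finite ({1..} - {x. 1 \<le> x \<and> 1 \<le> int x + k})"
    by (rule finite_subset) simp
qed auto

text \<open>If \<open>z\<close> exceeds \<open>x\<close> by more than \<open>f x\<close>, then \<open>f z = f x - (z - x)\<close> would be negative,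
  so \<open>z\<close> is displaced by the same amount as \<open>x\<close>.\<close>

lemma isometry_on_unbounded_is_translation:
  fixes f :: "nat \<Rightarrow> nat"
  assumes inf: "infinite D"
    and iso: "\<And>x y. x \<in> D \<Longrightarrow> y \<in> D \<Longrightarrow> \<bar>int (f x) - int (f y)\<bar> = \<bar>int x - int y\<bar>"
  obtains k where "\<And>x. x \<in> D \<Longrightarrow> int (f x) = int x + k"
proof -
  have same: "int (f x) - int x = int (f y) - int y" if "x \<in> D" "y \<in> D" for x y
  proof -
    obtain z where z: "z \<in> D" "z > x + f x + y + f y"
      using inf finite_nat_set_iff_bounded_le[of D] by (meson not_le_imp_less)
    show ?thesis
      using iso[OF z(1) that(1)] iso[OF z(1) that(2)] z(2) by linarith
  qed
  obtain a where "a \<in> D"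
    using inf by (metis finite.emptyI ex_in_conv)
  show thesis
  proof (rule that)
    show "int (f x) = int x + (int (f a) - int a)" if "x \<in> D" for x
      using same[OF that \<open>a \<in> D\<close>] by linarith
  qed
qed

lemma dom_infinite:
  assumes "\<alpha> \<in> partial_cofinite_isometries"
  shows "infinite (dom \<alpha>)"
proof
  assume "finite (dom \<alpha>)"
  moreover have "finite ({1..} - dom \<alpha>)"
    using assms by (simp add: partial_cofinite_isometries_def)
  ultimately have "finite {1::nat..}"
    by (meson finite_Diff2)
  then show False
    by (simp add: infinite_Ici)
qed

lemma mem_translationE:
  assumes "\<alpha> \<in> partial_cofinite_isometries"
  obtains k where "\<alpha> = translation_on k (dom \<alpha>)"
    and "\<And>x. x \<in> dom \<alpha> \<Longrightarrow> 1 \<le> int x + k"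
proof -
  note A = assms[unfolded partial_cofinite_isometries_def mem_Collect_eq]
  obtain k where k: "\<And>x. x \<in> dom \<alpha> \<Longrightarrow> int (the (\<alpha> x)) = int x + k"
    using isometry_on_unbounded_is_translation[OF dom_infinite[OF assms], of "\<lambda>x. the (\<alpha> x)"] A
    by blast
  have "\<alpha> x = translation_on k (dom \<alpha>) x" for x
    using k[of x] by (force simp: translation_on_def dom_def)
  moreover have "1 \<le> int x + k" if "x \<in> dom \<alpha>" for x
  proof -
    have "the (\<alpha> x) \<in> ran \<alpha>"
      using that by (auto intro: ranI)
    then have "1 \<le> the (\<alpha> x)"
      using A by auto
    then show ?thesis
      using k[OF that] by linarith
  qed
  ultimately show thesis
    using that by blast
qed

section \<open>The inverse semigroup structure\<close>

lemma comp_mem: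
  assumes "\<alpha> \<in> partial_cofinite_isometries" "\<beta> \<in> partial_cofinite_isometries"
  shows "\<beta> \<circ>\<^sub>m \<alpha> \<in> partial_cofinite_isometries"
proof -
  note A = assms[unfolded partial_cofinite_isometries_def mem_Collect_eq]
  obtain k where k: "\<alpha> = translation_on k (dom \<alpha>)" "\<And>x. x \<in> dom \<alpha> \<Longrightarrow> 1 \<le> int x + k"
    using mem_translationE[OF assms(1)] by blast
  obtain l where l: "\<beta> = translation_on l (dom \<beta>)" "\<And>x. x \<in> dom \<beta> \<Longrightarrow> 1 \<le> int x + l"
    using mem_translationE[OF assms(2)] by blast
  let ?D = "{x \<in> dom \<alpha>. nat (int x + k) \<in> dom \<beta>}"
  have "\<beta> \<circ>\<^sub>m \<alpha> = translation_on (k + l) ?D"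
    using translation_on_comp[OF k(2), of "dom \<alpha>" l "dom \<beta>"] k(1) l(1) by metis
  moreover have "translation_on (k + l) ?D \<in> partial_cofinite_isometries"
  proof (rule translation_on_mem)
    show "?D \<subseteq> {1..}"
      using A by auto
    have "{1..} - ?D
        \<subseteq> ({1..} - dom \<alpha>) \<union> (\<lambda>x. int x + k) -` (int ` ({1..} - dom \<beta>))"
    proof
      fix x assume x: "x \<in> {1..} - ?D"
      show "x \<in> ({1..} - dom \<alpha>) \<union> (\<lambda>x. int x + k) -` (int ` ({1..} - dom \<beta>))"
      proof (cases "x \<in> dom \<alpha>")
        case True
        then have "int x + k = int (nat (int x + k))" "nat (int x + k) \<in> {1..} - dom \<beta>"
          using x k(2)[of x] by auto
        then show ?thesis
          by (metis UnI2 image_eqI vimageI)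
      qed (use x in auto)
    qed
    moreover have "finite ((\<lambda>x. int x + k) -` (int ` ({1..} - dom \<beta>)))"
      using A by (intro finite_vimageI) (auto simp: inj_def)
    ultimately show "finite ({1..} - ?D)"
      using A by (meson finite_UnI finite_subset)
    show "1 \<le> int x + (k + l)" if "x \<in> ?D" for x
      using that k(2)[of x] l(2)[of "nat (int x + k)"] by auto
  qed
  ultimately show ?thesis
    by simp
qed

lemma converse_mem:
  assumes "\<alpha> \<in> partial_cofinite_isometries"
  obtains \<beta> where "\<beta> \<in> partial_cofinite_isometries"
    and "\<And>x y. \<beta> y = Some x \<longleftrightarrow> \<alpha> x = Some y"
proof -
  note A = assms[unfolded partial_cofinite_isometries_def mem_Collect_eq]
  obtain k where k: "\<alpha> = translation_on k (dom \<alpha>)" "\<And>x. x \<in> dom \<alpha> \<Longrightarrow> 1 \<le> int x + k"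
    using mem_translationE[OF assms] by blast
  have ran: "ran \<alpha> = (\<lambda>x. nat (int x + k)) ` dom \<alpha>"
    by (subst k(1), rule ran_translation_on)
  have "translation_on (- k) (ran \<alpha>) \<in> partial_cofinite_isometries"
  proof (rule translation_on_mem)
    show "1 \<le> int y + - k" if y: "y \<in> ran \<alpha>" for y
    proof -
      obtain x where "x \<in> dom \<alpha>" "y = nat (int x + k)"
        using y ran by auto
      moreover from this have "1 \<le> x"
        using A by auto
      ultimately show ?thesis
        using k(2)[of x] by simp
    qed
  qed (use A in auto)
  moreover have "translation_on (- k) (ran \<alpha>) y = Some x \<longleftrightarrow> \<alpha> x = Some y" for x y
  proof
    assume L: "translation_on (- k) (ran \<alpha>) y = Some x"
    then obtain x' where x': "x' \<in> dom \<alpha>" "y = nat (int x' + k)"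
      using ran by (auto simp: translation_on_def split: if_splits)
    moreover have "x = x'"
      using L x' k(2)[of x'] by (auto simp: translation_on_def split: if_splits)
    ultimately show "\<alpha> x = Some y"
      by (subst k(1)) (simp add: translation_on_def)
  next
    assume R: "\<alpha> x = Some y"
    then have x: "x \<in> dom \<alpha>"
      by auto
    have "y = nat (int x + k)"
      using R x by (subst (asm) k(1)) (simp add: translation_on_def)
    then show "translation_on (- k) (ran \<alpha>) y = Some x"
      using k(2)[OF x] ranI[of \<alpha>, OF R] by (auto simp: translation_on_def)
  qed
  ultimately show thesis
    using that by blast
qed

text \<open>By injectivity, \<open>\<alpha>\<beta>\<alpha> = \<alpha>\<close> makes \<open>\<beta>\<close> undo \<open>\<alpha>\<close>, and \<open>\<beta>\<alpha>\<beta> = \<beta>\<close> makes \<open>\<alpha>\<close> undo \<open>\<beta>\<close>.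
  Since the converse relation determines \<open>\<beta>\<close>, this gives both existence and uniqueness of
  inverses.\<close>

lemma mutually_inverse_iff_converse:
  assumes inj: "\<And>x x' y. \<alpha> x = Some y \<Longrightarrow> \<alpha> x' = Some y \<Longrightarrow> x = x'"
    "\<And>y y' x. \<beta> y = Some x \<Longrightarrow> \<beta> y' = Some x \<Longrightarrow> y = y'"
  shows "\<alpha> \<circ>\<^sub>m (\<beta> \<circ>\<^sub>m \<alpha>) = \<alpha> \<and> \<beta> \<circ>\<^sub>m (\<alpha> \<circ>\<^sub>m \<beta>) = \<beta>
    \<longleftrightarrow> (\<forall>x y. \<beta> y = Some x \<longleftrightarrow> \<alpha> x = Some y)"
proof
  assume inv: "\<alpha> \<circ>\<^sub>m (\<beta> \<circ>\<^sub>m \<alpha>) = \<alpha> \<and> \<beta> \<circ>\<^sub>m (\<alpha> \<circ>\<^sub>m \<beta>) = \<beta>"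
  have undo: "g y = Some x"
    if fgf: "f \<circ>\<^sub>m (g \<circ>\<^sub>m f) = f"
      and inj: "\<And>x x' y. f x = Some y \<Longrightarrow> f x' = Some y \<Longrightarrow> x = x'"
      and fx: "f x = Some y"
    for f :: "'c \<rightharpoonup> 'd" and g :: "'d \<rightharpoonup> 'c" and x y
  proof -
    have "(f \<circ>\<^sub>m (g \<circ>\<^sub>m f)) x = Some y"
      using fgf fx by simp
    then obtain x' where "g y = Some x'" "f x' = Some y"
      using fx by (auto simp: map_comp_def split: option.splits)
    then show ?thesis
      using inj[OF fx] by simp
  qed
  have "\<beta> y = Some x" if "\<alpha> x = Some y" for x y
    by (rule undo[OF conjunct1[OF inv] _ that]) (rule inj(1))
  moreover have "\<alpha> x = Some y" if "\<beta> y = Some x" for x y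
    by (rule undo[OF conjunct2[OF inv] _ that]) (rule inj(2))
  ultimately show "\<forall>x y. \<beta> y = Some x \<longleftrightarrow> \<alpha> x = Some y"
    by (intro allI iffI)
next
  assume conv: "\<forall>x y. \<beta> y = Some x \<longleftrightarrow> \<alpha> x = Some y"
  have "(\<alpha> \<circ>\<^sub>m (\<beta> \<circ>\<^sub>m \<alpha>)) x = \<alpha> x" for x
    using conv by (cases "\<alpha> x") (auto simp: map_comp_def split: option.splits)
  moreover have "(\<beta> \<circ>\<^sub>m (\<alpha> \<circ>\<^sub>m \<beta>)) y = \<beta> y" for y
    using conv by (cases "\<beta> y") (auto simp: map_comp_def split: option.splits)
  ultimately show "\<alpha> \<circ>\<^sub>m (\<beta> \<circ>\<^sub>m \<alpha>) = \<alpha> \<and> \<beta> \<circ>\<^sub>m (\<alpha> \<circ>\<^sub>m \<beta>) = \<beta>"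
    by blast
qed

lemma mem_injective:
  assumes "\<alpha> \<in> partial_cofinite_isometries" "\<alpha> x = Some y" "\<alpha> x' = Some y"
  shows "x = x'"
proof -
  have "\<bar>int (the (\<alpha> x)) - int (the (\<alpha> x'))\<bar> = \<bar>int x - int x'\<bar>"
    using assms unfolding partial_cofinite_isometries_def by blast
  then show ?thesis
    using assms by simp
qed

lemma IN_infinity_inverse_semigroup: "inverse_semigroup IN_infinity"
proof (unfold_locales, simp_all add: IN_infinity_def comp_mem)
  fix \<alpha> \<beta> \<gamma> :: "nat \<rightharpoonup> nat"
  show "\<gamma> \<circ>\<^sub>m (\<beta> \<circ>\<^sub>m \<alpha>) = \<gamma> \<circ>\<^sub>m \<beta> \<circ>\<^sub>m \<alpha>"
    by (auto simp: map_comp_def split: option.splits)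
next
  fix \<alpha> assume \<alpha>: "\<alpha> \<in> partial_cofinite_isometries"
  have iff: "\<alpha> \<circ>\<^sub>m (\<beta> \<circ>\<^sub>m \<alpha>) = \<alpha> \<and> \<beta> \<circ>\<^sub>m (\<alpha> \<circ>\<^sub>m \<beta>) = \<beta>
    \<longleftrightarrow> (\<forall>x y. \<beta> y = Some x \<longleftrightarrow> \<alpha> x = Some y)"
    if "\<beta> \<in> partial_cofinite_isometries" for \<beta>
    by (rule mutually_inverse_iff_converse)
      (erule mem_injective[OF \<alpha>] mem_injective[OF that], assumption)+
  obtain \<beta> where \<beta>: "\<beta> \<in> partial_cofinite_isometries"
    "\<And>x y. \<beta> y = Some x \<longleftrightarrow> \<alpha> x = Some y"
    using converse_mem[OF \<alpha>] by blast
  show "\<exists>!\<beta>. \<beta> \<in> partial_cofinite_isometries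
    \<and> \<alpha> \<circ>\<^sub>m (\<beta> \<circ>\<^sub>m \<alpha>) = \<alpha> \<and> \<beta> \<circ>\<^sub>m (\<alpha> \<circ>\<^sub>m \<beta>) = \<beta>"
  proof (rule ex1I[of _ \<beta>])
    show "\<beta> \<in> partial_cofinite_isometries
      \<and> \<alpha> \<circ>\<^sub>m (\<beta> \<circ>\<^sub>m \<alpha>) = \<alpha> \<and> \<beta> \<circ>\<^sub>m (\<alpha> \<circ>\<^sub>m \<beta>) = \<beta>"
      using \<beta>(1) iff[OF \<beta>(1)] \<beta>(2) by simp
  next
    fix \<gamma>
    assume \<gamma>: "\<gamma> \<in> partial_cofinite_isometries
      \<and> \<alpha> \<circ>\<^sub>m (\<gamma> \<circ>\<^sub>m \<alpha>) = \<alpha> \<and> \<gamma> \<circ>\<^sub>m (\<alpha> \<circ>\<^sub>m \<gamma>) = \<gamma>"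
    then have "\<forall>x y. \<gamma> y = Some x \<longleftrightarrow> \<alpha> x = Some y"
      by (intro iffD1[OF iff]) (rule conjunct1, assumption, rule conjunct2, assumption)
    then have conv: "\<gamma> y = Some x \<longleftrightarrow> \<alpha> x = Some y" for x y
      by (elim allE)
    show "\<gamma> = \<beta>"
    proof
      fix y
      show "\<gamma> y = \<beta> y"
        using conv \<beta>(2) by (metis not_Some_eq)
    qed
  qed
qed

section \<open>The greatest element of a congruence class\<close>

lemma partial_identity_idempotent:
  assumes "A \<subseteq> {1..}" "finite ({1..} - A)"
  shows "translation_on 0 A \<in> idempotents IN_infinity"
proof -
  have "translation_on 0 A \<in> partial_cofinite_isometries"
    using assms by (intro translation_on_mem) auto
  moreover have "translation_on 0 A \<circ>\<^sub>m translation_on 0 A = translation_on 0 A"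
    by (auto simp: translation_on_def map_comp_def)
  ultimately show ?thesis
    by (simp add: idempotents_def IN_infinity_def)
qed

text \<open>The product of the witnessing idempotent with \<open>s\<close> is again cofinite, so it is defined
  somewhere; there \<open>s\<close> and \<open>t\<close> take the same value.\<close>

lemma least_group_congruence_same_displacement:
  assumes rel: "(s, t) \<in> least_group_congruence IN_infinity"
    and s: "s = translation_on k (dom s)" "\<And>x. x \<in> dom s \<Longrightarrow> 1 \<le> int x + k"
    and t: "t = translation_on l (dom t)" "\<And>x. x \<in> dom t \<Longrightarrow> 1 \<le> int x + l"
  shows "k = l"
proof -
  obtain e where e: "e \<in> partial_cofinite_isometries" "s \<circ>\<^sub>m e = t \<circ>\<^sub>m e"
    and "s \<in> partial_cofinite_isometries"
    using rel by (auto simp: least_group_congruence_def idempotents_def IN_infinity_def)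
  then have "infinite (dom (s \<circ>\<^sub>m e))"
    by (intro dom_infinite comp_mem)
  then obtain x where "x \<in> dom (s \<circ>\<^sub>m e)"
    by (metis finite.emptyI ex_in_conv)
  then obtain z where z: "(s \<circ>\<^sub>m e) x = Some z"
    by blast
  with e(2) have "(t \<circ>\<^sub>m e) x = Some z"
    by simp
  with z obtain y where y: "s y = Some z" "t y = Some z"
    by (auto simp: map_comp_def split: option.splits)
  then have "y \<in> dom s" "y \<in> dom t"
    by auto
  moreover from this have "z = nat (int y + k)" "z = nat (int y + l)"
    using y s(1) t(1) by (metis option.inject translation_on_def)+
  ultimately show ?thesis
    using s(2)[of y] t(2)[of y] by linarith
qed

text \<open>Translations with equal displacement agree on the domain of the smaller one, so
  restriction to that domain witnesses the congruence.\<close>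

lemma full_translation_congruent:
  assumes "s \<in> partial_cofinite_isometries"
    and s: "s = translation_on k (dom s)" "\<And>x. x \<in> dom s \<Longrightarrow> 1 \<le> int x + k"
  shows "(s, full_translation k) \<in> least_group_congruence IN_infinity"
proof -
  note A = assms(1)[unfolded partial_cofinite_isometries_def mem_Collect_eq]
  have "translation_on 0 (dom s) \<in> idempotents IN_infinity"
    using A by (intro partial_identity_idempotent) auto
  moreover have "s \<circ>\<^sub>m translation_on 0 (dom s) = full_translation k \<circ>\<^sub>m translation_on 0 (dom s)"
  proof
    fix x
    have "s x = full_translation k x" if "x \<in> dom s"
    proof -
      have "s x = Some (nat (int x + k))"
        using that by (subst s(1)) (simp add: translation_on_def)
      moreover have "1 \<le> x"
        using A that by auto
      ultimately show ?thesis
        using s(2)[OF that] by (simp add: full_translation_def translation_on_def)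
    qed
    then show "(s \<circ>\<^sub>m translation_on 0 (dom s)) x
      = (full_translation k \<circ>\<^sub>m translation_on 0 (dom s)) x"
      by (simp add: map_comp_def translation_on_def)
  qed
  ultimately show ?thesis
    using assms(1) full_translation_mem
    by (auto simp: least_group_congruence_def IN_infinity_def)
qed

text \<open>In the natural order the idempotent stands on the right and products act from left to
  right, so here the range rather than the domain has to be cut down.\<close>

lemma le_full_translation:
  assumes "s \<in> partial_cofinite_isometries"
    and s: "s = translation_on k (dom s)" "\<And>x. x \<in> dom s \<Longrightarrow> 1 \<le> int x + k"
  shows "s \<sqsubseteq>\<^bsub>natural_order IN_infinity\<^esub> full_translation k"
proof -
  note A = assms(1)[unfolded partial_cofinite_isometries_def mem_Collect_eq]
  have ran: "ran s = (\<lambda>x. nat (int x + k)) ` dom s"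
    by (subst s(1), rule ran_translation_on)
  have "translation_on 0 (ran s) \<in> idempotents IN_infinity"
    using A by (intro partial_identity_idempotent) auto
  moreover have "s = translation_on 0 (ran s) \<circ>\<^sub>m full_translation k"
  proof -
    have "{x \<in> {x. 1 \<le> x \<and> 1 \<le> int x + k}. nat (int x + k) \<in> ran s} = dom s"
    proof (intro equalityI subsetI)
      fix x assume "x \<in> {x \<in> {x. 1 \<le> x \<and> 1 \<le> int x + k}. nat (int x + k) \<in> ran s}"
      then obtain x' where "x' \<in> dom s" "nat (int x + k) = nat (int x' + k)" "1 \<le> int x + k"
        using ran by auto
      moreover from this have "x = x'"
        using s(2)[of x'] by linarith
      ultimately show "x \<in> dom s"
        by simp
    next
      fix x assume "x \<in> dom s"
      then show "x \<in> {x \<in> {x. 1 \<le> x \<and> 1 \<le> int x + k}. nat (int x + k) \<in> ran s}"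
        using A s(2)[of x] ran by auto
    qed
    then have "translation_on 0 (ran s) \<circ>\<^sub>m full_translation k = translation_on k (dom s)"
      unfolding full_translation_def by (subst translation_on_comp) auto
    then show ?thesis
      using s(1) by metis
  qed
  ultimately show ?thesis
    by (auto simp: natural_order_def IN_infinity_def)
qed

theorem mainTheorem6:
  shows "F_inverse_semigroup IN_infinity"
proof -
  interpret inverse_semigroup IN_infinity
    by (rule IN_infinity_inverse_semigroup)
  show ?thesis
  proof unfold_locales
    fix s assume "s \<in> carrier IN_infinity"
    then have mem: "s \<in> partial_cofinite_isometries"
      by (simp add: IN_infinity_def)
    obtain k where s: "s = translation_on k (dom s)" "\<And>x. x \<in> dom s \<Longrightarrow> 1 \<le> int x + k"
      using mem_translationE[OF mem] by blast
    have "t \<sqsubseteq>\<^bsub>natural_order IN_infinity\<^esub> full_translation k"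
      if rel: "(s, t) \<in> least_group_congruence IN_infinity" for t
    proof -
      have t: "t \<in> partial_cofinite_isometries"
        using rel by (auto simp: least_group_congruence_def IN_infinity_def)
      obtain l where l: "t = translation_on l (dom t)" "\<And>x. x \<in> dom t \<Longrightarrow> 1 \<le> int x + l"
        using mem_translationE[OF t] by blast
      have "k = l"
        by (rule least_group_congruence_same_displacement[OF rel s l])
      then show ?thesis
        using le_full_translation[OF t l] by simp
    qed
    moreover have "least_group_congruence IN_infinity `` {s} \<subseteq> carrier (natural_order IN_infinity)"
      by (auto simp: least_group_congruence_def natural_order_def)
    ultimately have "greatest (natural_order IN_infinity) (full_translation k)
        (least_group_congruence IN_infinity `` {s})"
      using full_translation_congruent[OF mem s] by (auto simp: greatest_def)
    then show "\<exists>m. greatest (natural_order IN_infinity) m (least_group_congruence IN_infinity `` {s})"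
      by blast
  qed
qed

end
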